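(* Let $n$ and $\ell$ be even positive integers, and let $k$ be the smallest nonnegative integer such that $\gcd(n-2k-1,\ell)=1$. If $0\le k\le 3$, then \[\max(n,\ell)=\binom{n}{2}-\left(\frac{n}{2}+k\right),\] and the $(n,\ell)$-extremal graphs are precisely the graphs $G$ of order $n$ whose complement $\overline{G}$ is a pendant graph (of order $n$ and size $\frac{n}{2}+k$), i.e. the complements of pendant graphs of order $n$, these complements having size $\binom{n}{2}-\left(\frac{n}{2}+k\right)$.
   Context: All graphs are finite and simple; $\overline{G}$ denotes the complement of $G$. Fix an integer $\ell\ge 2$; vertex labels lie in $\mathbb{Z}_\ell$. In the neighborhood Lights Out game on a graph $G$, one starts with a labeling $V(G)\to\mathbb{Z}_\ell$; toggling a vertex $v$ adds $1$ (mod $\ell$) to the label of every vertex of the closed neighborhood $N[v]$; the game is won when every label is $0$. $G$ is called $N$-AW (always winnable) if the game can be won from every initial labeling (equivalently, the matrix $A(G)+I$ is invertible over $\mathbb{Z}_\ell$). $\max(n,\ell)$ is the maximum number of edges of an $N$-AW graph on $n$ vertices, and an $(n,\ell)$-extremal graph is an $N$-AW graph of order $n$ with exactly $\max(n,\ell)$ edges. For a graph $H$, $H\odot K_1$ is the graph obtained from $H$ by adding, for each vertex $u$ of $H$, a new vertex adjacent only to $u$; a pendant graph is a graph of the form $H\odot K_1$. *)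

theory Defs
  imports Main
begin

definition graph :: "'a set \<Rightarrow> 'a set set \<Rightarrow> bool" where
  "graph V E \<longleftrightarrow> finite V \<and> (\<forall>e\<in>E. e \<subseteq> V \<and> card e = 2)"

definition compl_edges :: "'a set \<Rightarrow> 'a set set \<Rightarrow> 'a set set" where
  "compl_edges V E = {{u, v} | u v. u \<in> V \<and> v \<in> V \<and> u \<noteq> v} - E"

definition graph_iso :: "'a set \<Rightarrow> 'a set set \<Rightarrow> 'b set \<Rightarrow> 'b set set \<Rightarrow> bool" where
  "graph_iso V E V' E' \<longleftrightarrow> (\<exists>f. bij_betw f V V' \<and>
      (\<forall>u\<in>V. \<forall>v\<in>V. {u, v} \<in> E \<longleftrightarrow> {f u, f v} \<in> E'))"

text \<open>The corona H \<odot> K1: a copy Inl u of each vertex of H, plus a new vertex Inr u adjacent only to Inl u.\<close>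
definition corona_V :: "'b set \<Rightarrow> ('b + 'b) set" where
  "corona_V VH = Inl ` VH \<union> Inr ` VH"

definition corona_E :: "'b set \<Rightarrow> 'b set set \<Rightarrow> ('b + 'b) set set" where
  "corona_E VH EH = (\<lambda>e. Inl ` e) ` EH \<union> {{Inl u, Inr u} | u. u \<in> VH}"

definition is_pendant :: "'a set \<Rightarrow> 'a set set \<Rightarrow> bool" where
  "is_pendant V E \<longleftrightarrow> graph V E \<and> (\<exists>(VH :: 'a set) EH. graph VH EH \<and>
      graph_iso (corona_V VH) (corona_E VH EH) V E)"

text \<open>Neighborhood Lights Out over Z_l: from every initial labeling c (labels taken mod l),
  there are toggle counts x such that all final labels are 0 mod l. Toggling v adds 1 to
  every vertex of N[v].\<close>
definition N_AW :: "nat \<Rightarrow> 'a set \<Rightarrow> 'a set set \<Rightarrow> bool" where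
  "N_AW l V E \<longleftrightarrow> (\<forall>c :: 'a \<Rightarrow> int. \<exists>x :: 'a \<Rightarrow> nat. \<forall>w\<in>V.
      (c w + (\<Sum>v\<in>V. if v = w \<or> {v, w} \<in> E then int (x v) else 0)) mod int l = 0)"

text \<open>max(n,l): maximum number of edges of an N-AW graph on n vertices
  (every graph of order n is isomorphic to one on {0..<n}).\<close>
definition max_edges :: "nat \<Rightarrow> nat \<Rightarrow> nat" where
  "max_edges n l = Max {card E | E. graph {0..<n} E \<and> N_AW l {0..<n} E}"

definition extremal :: "nat \<Rightarrow> nat \<Rightarrow> 'a set \<Rightarrow> 'a set set \<Rightarrow> bool" where
  "extremal n l V E \<longleftrightarrow> graph V E \<and> card V = n \<and> N_AW l V E \<and> card E = max_edges n l"

end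

theory Submission
  imports Defs
begin

text \<open>
  Let \<open>A\<close> be the adjacency matrix of the complement \<open>H\<close> of \<open>G\<close>; the game matrix is \<open>J - A\<close>.
  If \<open>A x = 1\<close> over the integers and \<open>s\<close> is the sum of the entries of \<open>x\<close>, then
  \<open>(J - A) x = (s - 1) 1\<close>, so always-winnability forces \<open>s - 1\<close> to be coprime to \<open>l\<close>, and it is
  equivalent to this if \<open>A\<close> is invertible over the integers. For a pendant graph with
  \<open>n/2 + k\<close> edges \<open>s = n - 2k\<close>.

  Conversely, since \<open>l\<close> and \<open>n\<close> are even, always-winnability makes \<open>A\<close> nonsingular modulo 2. A graph
  nonsingular modulo 2 with at most \<open>n/2 + 3\<close> edges always has a leaf, and deleting a leaf
  with its neighbour preserves both properties, so \<open>H\<close> is exhausted by such deletions.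
  Following \<open>s\<close> through this elimination shows \<open>s = n - 2i\<close> with \<open>0 \<le> i \<le> j\<close> where \<open>H\<close> has \<open>n/2 + j\<close>
  edges, and \<open>i = j\<close> only for pendant graphs. Minimality of \<open>k\<close> then gives \<open>k \<le> i \<le> j\<close>.
\<close>

section \<open>Leaf elimination\<close>

declare sum_of_bool_eq [simp del] sum_of_bool_mult_eq [simp del] sum_mult_of_bool_eq [simp del]

fun verts :: "('a \<times> 'a) list \<Rightarrow> 'a set" where
  "verts [] = {}"
| "verts ((u, v) # ps) = insert u (insert v (verts ps))"

text \<open>In a pair \<open>(u, v)\<close> the second vertex is a leaf of the graph induced on this
  pair and all later ones, and \<open>u\<close> is its neighbour. The head of the list is deleted
  first.\<close>

fun leaf_elim :: "('a \<Rightarrow> 'a \<Rightarrow> bool) \<Rightarrow> ('a \<times> 'a) list \<Rightarrow> bool" where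
  "leaf_elim adj [] \<longleftrightarrow> True"
| "leaf_elim adj ((u, v) # ps) \<longleftrightarrow> u \<noteq> v \<and> u \<notin> verts ps \<and> v \<notin> verts ps \<and> adj u v \<and>
     (\<forall>w\<in>verts ps. \<not> adj v w) \<and> leaf_elim adj ps"

text \<open>Counts the edges outside the perfect matching formed by the pairs. Each is charged to
  the earliest pair that it meets, where only \<open>u\<close> can be its end, since
  \<open>v\<close> is a leaf by then.\<close>

fun extra :: "('a \<Rightarrow> 'a \<Rightarrow> bool) \<Rightarrow> ('a \<times> 'a) list \<Rightarrow> int" where
  "extra adj [] = 0"
| "extra adj ((u, v) # ps) = (\<Sum>w\<in>verts ps. of_bool (adj u w)) + extra adj ps"

text \<open>Clearing the row and column of \<open>u\<close> by means of the leaf \<open>v\<close> subtracts \<open>c v\<close> from the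
  entries of \<open>c\<close> at the other neighbours of \<open>u\<close> and leaves a block contributing \<open>2 * c u * c v\<close>;
  so \<open>2 * elim_form adj ps c\<close> is the value of the quadratic form of the inverse adjacency matrix
  at \<open>c\<close>. The function \<open>deficit\<close> below is \<open>length ps - elim_form adj ps c\<close> rewritten in \<open>a = 1 - c\<close>.\<close>
fun elim_form :: "('a \<Rightarrow> 'a \<Rightarrow> bool) \<Rightarrow> ('a \<times> 'a) list \<Rightarrow> ('a \<Rightarrow> int) \<Rightarrow> int" where
  "elim_form adj [] c = 0"
| "elim_form adj ((u, v) # ps) c =
     c u * c v + elim_form adj ps (\<lambda>w. c w - of_bool (adj u w) * c v)"

fun deficit :: "('a \<Rightarrow> 'a \<Rightarrow> bool) \<Rightarrow> ('a \<times> 'a) list \<Rightarrow> ('a \<Rightarrow> int) \<Rightarrow> int" where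
  "deficit adj [] a = 0"
| "deficit adj ((u, v) # ps) a =
     a u + a v - a u * a v + deficit adj ps (\<lambda>w. a w + of_bool (adj u w) * (1 - a v))"

lemma finite_verts [simp]: "finite (verts ps)"
  by (induction ps rule: verts.induct) auto

lemma extra_nonneg: "0 \<le> extra adj ps"
  by (induction ps rule: verts.induct) (auto intro!: add_nonneg_nonneg sum_nonneg)

lemma card_verts: "leaf_elim adj ps \<Longrightarrow> card (verts ps) = 2 * length ps"
  by (induction ps rule: verts.induct) auto

lemma in_verts: "(u, v) \<in> set ps \<Longrightarrow> u \<in> verts ps \<and> v \<in> verts ps"
  by (induction ps rule: verts.induct) auto

lemma elim_form_deficit:
  "elim_form adj ps (\<lambda>w. 1 - a w) = int (length ps) - deficit adj ps a"
proof (induction ps arbitrary: a rule: verts.induct)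
  case (2 u v ps)
  have "(\<lambda>w. (1 - a w) - of_bool (adj u w) * (1 - a v)) = (\<lambda>w. 1 - (a w + of_bool (adj u w) * (1 - a v)))"
    by (auto simp: algebra_simps)
  then show ?case
    using "2.IH"[of "\<lambda>w. a w + of_bool (adj u w) * (1 - a v)"]
    by (simp add: algebra_simps)
qed simp

section \<open>Bounds for the deficit\<close>

lemma deficit_cong:
  "(\<And>w. w \<in> verts ps \<Longrightarrow> a w = b w) \<Longrightarrow> deficit adj ps a = deficit adj ps b"
proof (induction ps arbitrary: a b rule: verts.induct)
  case (2 u v ps)
  have "deficit adj ps (\<lambda>w. a w + of_bool (adj u w) * (1 - a v)) =
        deficit adj ps (\<lambda>w. b w + of_bool (adj u w) * (1 - b v))"
    by (rule "2.IH") (simp add: "2.prems")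
  then show ?case using "2.prems" by simp
qed simp

lemma sum_adj_eq_0_iff:
  "finite W \<Longrightarrow> (\<Sum>w\<in>W. of_bool (adj u w) :: int) = 0 \<longleftrightarrow> (\<forall>w\<in>W. \<not> adj u w)"
  by (subst sum_nonneg_eq_0_iff) auto

text \<open>Without extra edges the graph is the matching itself, so later entries of
  \<open>a\<close> never change. Nonpositive integers of total at least -1 have at most one nonzero
  entry, so every product \<open>a u * a v\<close> vanishes. This serves the only case of
  \<open>deficit_bounds\<close> in which an entry becomes negative.\<close>

lemma deficit_no_extra:
  assumes "leaf_elim adj ps" "extra adj ps = 0" "\<And>w. w \<in> verts ps \<Longrightarrow> a w \<le> 0"
    "- 1 \<le> (\<Sum>w\<in>verts ps. a w)"
  shows "deficit adj ps a = (\<Sum>w\<in>verts ps. a w)"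
  using assms
proof (induction ps arbitrary: a rule: verts.induct)
  case (2 u v ps)
  have nn: "0 \<le> (\<Sum>w\<in>verts ps. of_bool (adj u w) :: int)" by (simp add: sum_nonneg)
  have e0: "(\<Sum>w\<in>verts ps. of_bool (adj u w) :: int) = 0" "extra adj ps = 0"
    using "2.prems"(2) nn extra_nonneg[of adj ps] unfolding extra.simps by linarith+
  have noadj: "\<forall>w\<in>verts ps. \<not> adj u w" using e0(1) by (simp add: sum_adj_eq_0_iff)
  have S: "(\<Sum>w\<in>verts ((u, v) # ps). a w) = a u + a v + (\<Sum>w\<in>verts ps. a w)"
    using "2.prems"(1) by simp
  have le: "a u \<le> 0" "a v \<le> 0" "(\<Sum>w\<in>verts ps. a w) \<le> 0"
    using "2.prems"(3) by (auto intro: sum_nonpos)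
  have t1: "- 1 \<le> (\<Sum>w\<in>verts ps. a w)" using "2.prems"(4) S le by linarith
  have "deficit adj ps (\<lambda>w. a w + of_bool (adj u w) * (1 - a v)) = deficit adj ps a"
    by (rule deficit_cong) (use noadj in auto)
  also have "\<dots> = (\<Sum>w\<in>verts ps. a w)"
    using "2.prems" t1 e0 by (intro "2.IH") auto
  finally have d: "deficit adj ps (\<lambda>w. a w + of_bool (adj u w) * (1 - a v)) = (\<Sum>w\<in>verts ps. a w)" .
  have "a u = 0 \<or> a v = 0" using "2.prems"(4) S le by linarith
  then show ?case using S d by auto
qed simp

text \<open>The quantity \<open>extra adj ps + sum a\<close> plays the role of a budget. Eliminating a pair with
  \<open>a v = 0\<close> converts edges into mass and spends exactly \<open>a u\<close>; if \<open>a v = 1\<close>, then all further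
  edges at \<open>u\<close> are lost. The mass can only become negative if \<open>a v = 2\<close> and \<open>u\<close> has one further
  neighbour, which exhausts the budget 3.\<close>
lemma deficit_bounds:
  assumes "symp adj" "irreflp adj" "leaf_elim adj ps" "\<And>w. w \<in> verts ps \<Longrightarrow> 0 \<le> a w"
    "extra adj ps + (\<Sum>w\<in>verts ps. a w) \<le> 3"
  shows "0 \<le> deficit adj ps a \<and> deficit adj ps a \<le> extra adj ps + (\<Sum>w\<in>verts ps. a w) \<and>
    (deficit adj ps a = extra adj ps + (\<Sum>w\<in>verts ps. a w) \<longrightarrow>
      (\<forall>(u, v)\<in>set ps. (a v = 0 \<and> (\<forall>w\<in>verts ps. adj v w \<longrightarrow> w = u)) \<or>
                       (a u = 0 \<and> (\<forall>w\<in>verts ps. adj u w \<longrightarrow> w = v))))"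
  using assms(3-)
proof (induction ps arbitrary: a rule: verts.induct)
  case (2 u v ps)
  define b where "b = (\<lambda>w. a w + of_bool (adj u w) * (1 - a v))"
  define d where "d = (\<Sum>w\<in>verts ps. of_bool (adj u w) :: int)"
  define t where "t = (\<Sum>w\<in>verts ps. a w)"
  define J where "J = extra adj ps"
  have sym: "adj x y \<longleftrightarrow> adj y x" for x y using assms(1) by (auto dest: sympD)
  have irr: "\<not> adj x x" for x using assms(2) by (auto dest: irreflpD)
  note le = "2.prems"(1)
  have d0: "0 \<le> d" by (simp add: d_def sum_nonneg)
  have J0: "0 \<le> J" by (simp add: J_def extra_nonneg)
  have a0: "0 \<le> a u" "0 \<le> a v" using "2.prems"(2) by auto
  have t0: "0 \<le> t" unfolding t_def using "2.prems"(2) by (intro sum_nonneg) auto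
  have S: "(\<Sum>w\<in>verts ((u, v) # ps). a w) = a u + a v + t"
    using le by (simp add: t_def)
  have ex: "extra adj ((u, v) # ps) = d + J" by (simp add: d_def J_def)
  have tot: "d + J + a u + a v + t \<le> 3" using "2.prems"(3) S ex by linarith
  have def: "deficit adj ((u, v) # ps) a = a u + a v - a u * a v + deficit adj ps b"
    by (simp add: b_def)
  have bsum: "(\<Sum>w\<in>verts ps. b w) = t + d * (1 - a v)"
    by (simp add: b_def t_def d_def sum.distrib sum_distrib_right)
  have noadj: "\<forall>w\<in>verts ps. \<not> adj u w" if "d = 0"
    using that by (simp add: d_def sum_adj_eq_0_iff)
  let ?G = "\<forall>(u, v)\<in>set ps. (b v = 0 \<and> (\<forall>w\<in>verts ps. adj v w \<longrightarrow> w = u)) \<or>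
                       (b u = 0 \<and> (\<forall>w\<in>verts ps. adj u w \<longrightarrow> w = v))"
  have IH: "0 \<le> deficit adj ps b \<and> deficit adj ps b \<le> J + (t + d * (1 - a v)) \<and>
    (deficit adj ps b = J + (t + d * (1 - a v)) \<longrightarrow>
      ?G)"
    if "\<And>w. w \<in> verts ps \<Longrightarrow> 0 \<le> b w" "J + (t + d * (1 - a v)) \<le> 3"
    using "2.IH"[of b] le that unfolding bsum J_def by simp
  consider (v0) "a v = 0" | (dz) "a v > 0" "d = 0" | (v1) "a v = 1" "d > 0" | (v2) "a v > 1" "d > 0"
    using a0 d0 by linarith
  then show ?case
  proof cases
    case v0
    have "0 \<le> b w" if "w \<in> verts ps" for w using "2.prems"(2) v0 that by (simp add: b_def)
    moreover have "J + (t + d * (1 - a v)) \<le> 3" using tot v0 a0 by simp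
    ultimately have IH: "0 \<le> deficit adj ps b" "deficit adj ps b \<le> J + (t + d)"
      "deficit adj ps b = J + (t + d) \<longrightarrow> ?G"
      using IH unfolding v0 diff_0_right mult_1_right by blast+
    have fin: "\<forall>(x, y)\<in>set ((u, v) # ps).
        (a y = 0 \<and> (\<forall>w\<in>verts ((u, v) # ps). adj y w \<longrightarrow> w = x)) \<or>
        (a x = 0 \<and> (\<forall>w\<in>verts ((u, v) # ps). adj x w \<longrightarrow> w = y))"
      if eq: "deficit adj ps b = J + (t + d)"
    proof -
      \<comment> \<open>Since \<open>a v = 0\<close>, \<open>b w\<close> is a sum of two nonnegative
        terms, so \<open>b w = 0\<close> passes back to \<open>a w = 0\<close> and excludes an edge
        from \<open>w\<close> to \<open>u\<close>.\<close>
      have b0: "a w = 0 \<and> \<not> adj w u \<and> \<not> adj w v" if "w \<in> verts ps" "b w = 0" for w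
      proof -
        have "0 \<le> a w" using "2.prems"(2) that(1) by simp
        moreover have "\<not> adj v w" using le that(1) by simp
        ultimately show ?thesis using that(2) v0 sym by (auto simp: b_def of_bool_def split: if_splits)
      qed
      have "(a y = 0 \<and> (\<forall>w\<in>verts ((u, v) # ps). adj y w \<longrightarrow> w = x)) \<or>
        (a x = 0 \<and> (\<forall>w\<in>verts ((u, v) # ps). adj x w \<longrightarrow> w = y))" if "(x, y) \<in> set ps" for x y
        using bspec[OF mp[OF IH(3) eq] that] b0[of x] b0[of y] in_verts[OF that] by auto
      moreover have "\<forall>w\<in>verts ((u, v) # ps). adj v w \<longrightarrow> w = u" using le irr by auto
      ultimately show ?thesis using v0 by auto
    qed
    show ?thesis unfolding def S ex using IH fin v0 a0 by auto
  next
    case dz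
    have ba: "b w = a w" if "w \<in> verts ps" for w using noadj[OF dz(2)] that by (simp add: b_def)
    have "0 \<le> b w" if "w \<in> verts ps" for w using "2.prems"(2) ba that by simp
    moreover have "J + (t + d * (1 - a v)) \<le> 3" using tot dz a0 by simp
    ultimately have IH: "0 \<le> deficit adj ps b" "deficit adj ps b \<le> J + t"
      "deficit adj ps b = J + t \<longrightarrow> ?G"
      using IH unfolding dz(2) mult_zero_left add_0_right by blast+
    have noadj': "\<not> adj w u \<and> \<not> adj w v" if "w \<in> verts ps" for w
      using noadj[OF dz(2)] le that sym by auto
    have fin: "\<forall>(x, y)\<in>set ((u, v) # ps).
        (a y = 0 \<and> (\<forall>w\<in>verts ((u, v) # ps). adj y w \<longrightarrow> w = x)) \<or>
        (a x = 0 \<and> (\<forall>w\<in>verts ((u, v) # ps). adj x w \<longrightarrow> w = y))"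
      if eq: "deficit adj ps b = J + t" and au: "a u = 0"
    proof -
      have "(a y = 0 \<and> (\<forall>w\<in>verts ((u, v) # ps). adj y w \<longrightarrow> w = x)) \<or>
        (a x = 0 \<and> (\<forall>w\<in>verts ((u, v) # ps). adj x w \<longrightarrow> w = y))" if "(x, y) \<in> set ps" for x y
        using bspec[OF mp[OF IH(3) eq] that] ba[of x] ba[of y] noadj'[of x] noadj'[of y] in_verts[OF that]
        by auto
      moreover have "\<forall>w\<in>verts ((u, v) # ps). adj u w \<longrightarrow> w = v"
        using noadj[OF dz(2)] irr by auto
      ultimately show ?thesis using au by auto
    qed
    \<comment> \<open>With \<open>a v > 0\<close> and \<open>a u + a v\<close> at most 3, the
      product never exceeds the sum and is positive unless \<open>a u = 0\<close>. The enumeration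
      makes the product linear.\<close>
    have "a v = 1 \<or> a v = 2 \<or> a v = 3" "a u = 0 \<or> a u = 1 \<or> a u = 2" using dz tot a0 J0 t0 by linarith+
    then have "0 \<le> a u + a v - a u * a v" "a u + a v - a u * a v \<le> a u + a v"
      "a u + a v - a u * a v = a u + a v \<Longrightarrow> a u = 0"
      using tot J0 t0 dz by auto
    then show ?thesis unfolding def S ex using IH(1,2) fin dz
      by (intro conjI impI; (rule fin)?; linarith)
  next
    case v1
    \<comment> \<open>Here \<open>b = a\<close>, and the pair contributes 1 whatever
      \<open>a u\<close> is. The \<open>d\<close> edges are not recovered, so the upper bound is
      strict and the equality clause is vacuous.\<close>
    have "0 \<le> deficit adj ps b \<and> deficit adj ps b \<le> J + t"
      using IH "2.prems"(2) tot a0 d0 v1 by (simp add: b_def)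
    then show ?thesis unfolding def S ex using v1 a0 by auto
  next
    case v2
    have vals: "a v = 2" "d = 1" "J = 0" "t = 0" "a u = 0" using v2 tot a0 J0 t0 by linarith+
    have "a w = 0" if "w \<in> verts ps" for w
      using vals(4) that "2.prems"(2) unfolding t_def by (subst (asm) sum_nonneg_eq_0_iff) auto
    \<comment> \<open>\<open>b\<close> is -1 at the single later neighbour of \<open>u\<close> and 0
      elsewhere on \<open>verts ps\<close>, so the deficit is 2 - 1 = 1, strictly below the total
      3.\<close>
    then have "deficit adj ps b = (\<Sum>w\<in>verts ps. b w)"
      using le vals bsum by (intro deficit_no_extra) (auto simp: J_def b_def)
    then show ?thesis unfolding def S ex using vals bsum by simp
  qed
qed simp

text \<open>Back substitution needs no division: row \<open>v\<close> forces the value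
  \<open>c v\<close> at \<open>u\<close>, the remaining rows then have right-hand side
  \<open>c'\<close>, and row \<open>u\<close> fixes the value at \<open>v\<close>. In the pairing
  with \<open>c\<close> the terms \<open>c v * xN\<close> cancel, so each pair adds twice the
  product of its two current entries.\<close>

lemma leaf_elim_solve:
  assumes "symp adj" "irreflp adj" "leaf_elim adj ps"
  shows "\<exists>x :: 'a \<Rightarrow> int. (\<forall>w\<in>verts ps. (\<Sum>z\<in>verts ps. of_bool (adj w z) * x z) = c w) \<and>
     (\<Sum>z\<in>verts ps. c z * x z) = 2 * elim_form adj ps c"
  using assms(3)
proof (induction ps arbitrary: c rule: verts.induct)
  case (2 u v ps)
  define c' where "c' = (\<lambda>w. c w - of_bool (adj u w) * c v)"
  have sym: "adj x y \<longleftrightarrow> adj y x" for x y using assms(1) by (auto dest: sympD)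
  have irr: "\<not> adj x x" for x using assms(2) by (auto dest: irreflpD)
  have le: "u \<noteq> v" "u \<notin> verts ps" "v \<notin> verts ps" "adj u v" "\<And>w. w\<in>verts ps \<Longrightarrow> \<not> adj v w" "leaf_elim adj ps"
    using "2.prems" by auto
  have out: "adj w u = adj u w" "\<not> adj w v" if "w \<in> verts ps" for w
    using le(5)[OF that] sym by auto
  have uv: "adj v u" "\<not> adj u u" "\<not> adj v v" using le(4) sym irr by auto
  obtain x where x: "\<And>w. w \<in> verts ps \<Longrightarrow> (\<Sum>z\<in>verts ps. of_bool (adj w z) * x z) = c' w"
    and s: "(\<Sum>z\<in>verts ps. c' z * x z) = 2 * elim_form adj ps c'"
    using "2.IH"[of c'] le by auto
  define xN where "xN = (\<Sum>z\<in>verts ps. of_bool (adj u z) * x z)"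
  define y where "y = (\<lambda>w. if w = u then c v else if w = v then c u - xN else x w)"
  have ysum: "(\<Sum>z\<in>verts ps. f z * y z) = (\<Sum>z\<in>verts ps. f z * x z)" for f :: "'a \<Rightarrow> int"
    by (rule sum.cong) (use le in \<open>auto simp: y_def\<close>)
  have split: "(\<Sum>z\<in>verts ((u, v) # ps). f z * y z) = f u * c v + f v * (c u - xN) + (\<Sum>z\<in>verts ps. f z * x z)"
    for f :: "'a \<Rightarrow> int"
    using le by (simp add: ysum) (simp add: y_def)
  have v0: "(\<Sum>z\<in>verts ps. of_bool (adj v z) * x z) = 0"
    by (rule sum.neutral) (use le in auto)
  have "\<forall>w\<in>verts ((u, v) # ps). (\<Sum>z\<in>verts ((u, v) # ps). of_bool (adj w z) * y z) = c w"
    unfolding split using le(4) x v0 out uv by (auto simp: xN_def c'_def)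
  moreover have "(\<Sum>z\<in>verts ps. c z * x z) = (\<Sum>z\<in>verts ps. c' z * x z) + c v * xN"
    by (simp add: c'_def xN_def sum_distrib_left flip: sum.distrib) (simp add: algebra_simps)
  then have "(\<Sum>z\<in>verts ((u, v) # ps). c z * y z) = 2 * elim_form adj ((u, v) # ps) c"
    unfolding split s by (simp add: c'_def algebra_simps)
  ultimately show ?case by blast
qed simp

text \<open>Every edge is either a pair of the list or counted once by \<open>extra\<close>, and is
  seen from both of its ends.\<close>

lemma leaf_elim_degree_sum:
  assumes "symp adj" "irreflp adj" "leaf_elim adj ps"
  shows "(\<Sum>w\<in>verts ps. \<Sum>z\<in>verts ps. of_bool (adj w z) :: int) = 2 * (int (length ps) + extra adj ps)"
  using assms(3)
proof (induction ps rule: verts.induct)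
  case (2 u v ps)
  have sym: "adj x y \<longleftrightarrow> adj y x" for x y using assms(1) by (auto dest: sympD)
  have irr: "\<not> adj x x" for x using assms(2) by (auto dest: irreflpD)
  have le: "u \<noteq> v" "u \<notin> verts ps" "v \<notin> verts ps" "adj u v" "\<And>w. w\<in>verts ps \<Longrightarrow> \<not> adj v w" "leaf_elim adj ps"
    using "2.prems" by auto
  have out: "adj w u = adj u w" "\<not> adj w v" if "w \<in> verts ps" for w
    using le(5)[OF that] sym by auto
  have uv: "adj v u" "\<not> adj u u" "\<not> adj v v" using le(4) sym irr by auto
  have v0: "(\<Sum>z\<in>verts ps. of_bool (adj v z) :: int) = 0"
      by (rule sum.neutral) (use le in auto)
  show ?case using "2.IH" le(1-4,6) v0 out uv
    by (simp add: sum.distrib)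
qed simp

section \<open>Nonsingularity modulo 2\<close>

text \<open>An alternating form modulo 2 has even rank. The induction splits off a pivot block on
  two indices with an odd entry between them; if all entries are even, the all-ones vector
  works.\<close>

lemma odd_alternating_kernel:
  fixes a :: "'a \<Rightarrow> 'a \<Rightarrow> int"
  assumes "finite V" "odd (card V)"
    and "\<And>u v. u \<in> V \<Longrightarrow> v \<in> V \<Longrightarrow> a u v = a v u" "\<And>u. u \<in> V \<Longrightarrow> even (a u u)"
  shows "\<exists>x. (\<exists>v\<in>V. odd (x v)) \<and> (\<forall>w\<in>V. even (\<Sum>z\<in>V. a w z * x z))"
  using assms
proof (induction "card V" arbitrary: V a rule: less_induct)
  case less
  note sym = less.prems(3) and diag = less.prems(4)
  show ?case
  proof (cases "\<exists>u\<in>V. \<exists>v\<in>V. odd (a u v)")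
    case False
    have "V \<noteq> {}" using less.prems(2) by auto
    then show ?thesis using False by (intro exI[of _ "\<lambda>_. 1"]) (auto intro!: dvd_sum)
  next
    case True
    then obtain u v where uv: "u \<in> V" "v \<in> V" "odd (a u v)" by auto
    then have ne: "u \<noteq> v" using diag by auto
    define V' where "V' = V - {u, v}"
    have V: "V = insert u (insert v V')" "u \<notin> V'" "v \<notin> V'" "finite V'"
      using uv less.prems(1) by (auto simp: V'_def)
    have cV: "card V = Suc (Suc (card V'))" using V ne by simp
    \<comment> \<open>the Schur complement of the pivot block on \<open>u\<close>, \<open>v\<close>, modulo 2\<close>
    define b where "b w z = a w z + a w u * a v z + a w v * a u z" for w z
    have "\<exists>x. (\<exists>v\<in>V'. odd (x v)) \<and> (\<forall>w\<in>V'. even (\<Sum>z\<in>V'. b w z * x z))"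
    proof (rule less.hyps)
      show "card V' < card V" "finite V'" "odd (card V')" using cV V less.prems(2) by auto
      show "b w z = b z w" if "w \<in> V'" "z \<in> V'" for w z
        using that sym[of w z] sym[of w u] sym[of w v] sym[of z u] sym[of z v] V(1) by (simp add: b_def)
      show "even (b w w)" if "w \<in> V'" for w
        using that diag[of w] sym[of w u] sym[of w v] V(1) by (simp add: b_def)
    qed
    then obtain x where x: "\<exists>v\<in>V'. odd (x v)" "\<And>w. w\<in>V' \<Longrightarrow> even (\<Sum>z\<in>V'. b w z * x z)" by auto
    define s where "s w = (\<Sum>z\<in>V'. a w z * x z)" for w
    \<comment> \<open>Modulo 2 the pivot block swaps its two coordinates and is its own inverse, so
      these values make rows \<open>u\<close> and \<open>v\<close> even.\<close>
    define y where "y = (\<lambda>w. if w = u then s v else if w = v then s u else x w)"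
    have ysum: "(\<Sum>z\<in>V. a w z * y z) = a w u * s v + a w v * s u + s w" for w
    proof -
      have "(\<Sum>z\<in>V'. a w z * y z) = s w" unfolding s_def
        by (rule sum.cong) (use V in \<open>auto simp: y_def\<close>)
      then show ?thesis using V ne by (simp add: y_def)
    qed
    have "even (\<Sum>z\<in>V. a w z * y z)" if w: "w \<in> V" for w
    proof -
      consider "w = u" | "w = v" | "w \<in> V'" using w V by auto
      then show ?thesis
      proof cases
        case 3
        have "(\<Sum>z\<in>V'. b w z * x z) = a w u * s v + a w v * s u + s w"
          by (simp add: b_def s_def sum_distrib_left algebra_simps sum.distrib)
        then show ?thesis unfolding ysum using x(2)[OF 3] by simp
      qed (use diag[OF uv(1)] diag[OF uv(2)] uv(3) sym[OF uv(1,2)] in \<open>auto simp: ysum\<close>)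
    qed
    moreover have "\<exists>w\<in>V. odd (y w)" using x(1) V by (auto simp: y_def)
    ultimately show ?thesis by blast
  qed
qed

definition nonsingular2 :: "('a \<Rightarrow> 'a \<Rightarrow> bool) \<Rightarrow> 'a set \<Rightarrow> bool" where
  "nonsingular2 adj W \<longleftrightarrow> (\<forall>x :: 'a \<Rightarrow> int.
     (\<forall>w\<in>W. even (\<Sum>z\<in>W. of_bool (adj w z) * x z)) \<longrightarrow> (\<forall>w\<in>W. even (x w)))"

lemma nonsingular2D:
  assumes "nonsingular2 adj W" "\<forall>w\<in>W. even (\<Sum>z\<in>W. of_bool (adj w z) * x z :: int)" "w \<in> W"
  shows "even (x w)"
  using assms unfolding nonsingular2_def by blast

lemma adj_form_swap:
  assumes "symp adj"
  shows "(\<Sum>w\<in>V. y w * (\<Sum>z\<in>V. of_bool (adj w z) * x z)) =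
         (\<Sum>z\<in>V. x z * (\<Sum>w\<in>V. of_bool (adj z w) * (y w :: int)))"
proof -
  have sym: "adj x y \<longleftrightarrow> adj y x" for x y using assms by (auto dest: sympD)
  show ?thesis
    by (simp add: sum_distrib_left, subst sum.swap, intro sum.cong refl) (simp add: sym mult_ac)
qed

text \<open>A kernel vector \<open>y\<close> of \<open>A\<close> with odd entry sum would be unique modulo 2. But deleting a vertex \<open>v\<close> with \<open>y v\<close> odd
  leaves an alternating matrix of odd size, whose kernel vector is also killed by row \<open>v\<close>
  (a combination of the other rows) and hence gives a second one.\<close>
lemma nonsingular2_of_compl:
  assumes "finite V" "even (card V)" "symp adj" "irreflp adj"
    and ker: "\<And>y w. (\<forall>w\<in>V. even ((\<Sum>z\<in>V. y z) - (\<Sum>z\<in>V. of_bool (adj w z) * y z))) \<Longrightarrow>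
         w \<in> V \<Longrightarrow> even (y w :: int)"
  shows "nonsingular2 adj V"
  unfolding nonsingular2_def
proof (intro allI impI)
  fix y :: "'a \<Rightarrow> int"
  assume y: "\<forall>w\<in>V. even (\<Sum>z\<in>V. of_bool (adj w z) * y z)"
  show "\<forall>w\<in>V. even (y w)"
  proof (rule ccontr)
    assume "\<not> ?thesis"
    then obtain v where v: "v \<in> V" "odd (y v)" by auto
    have oddsum: "odd (\<Sum>z\<in>V. y z)" using ker[of y v] y v by auto
    let ?W = "V - {v}"
    have "\<exists>x. (\<exists>v\<in>?W. odd (x v)) \<and> (\<forall>w\<in>?W. even (\<Sum>z\<in>?W. of_bool (adj w z) * x z :: int))"
      using assms(1-4) v(1) by (intro odd_alternating_kernel) (auto dest: sympD irreflpD)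
    then obtain x0 v' where x0: "v' \<in> ?W" "odd (x0 v')"
      "\<And>w. w \<in> ?W \<Longrightarrow> even (\<Sum>z\<in>?W. of_bool (adj w z) * x0 z :: int)" by auto
    \<comment> \<open>Extending by 0 keeps all rows other than \<open>v\<close> even and makes
      \<open>x\<close> differ from \<open>y\<close> modulo 2 at \<open>v\<close>.\<close>
    define x where "x = x0(v := 0)"
    have xs: "(\<Sum>z\<in>V. of_bool (adj w z) * x z) = (\<Sum>z\<in>?W. of_bool (adj w z) * x0 z)" for w
      using assms(1) v(1) by (subst sum.remove[of V v]) (auto simp: x_def)
    \<comment> \<open>After transposition this is \<open>x\<close> paired with \<open>A y\<close>,
      hence even. All terms other than that of \<open>v\<close> are even and \<open>y v\<close> is
      odd, so row \<open>v\<close> is even as well.\<close>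
    have "even (\<Sum>w\<in>V. y w * (\<Sum>z\<in>V. of_bool (adj w z) * x z))"
      using y by (subst adj_form_swap[OF assms(3)]) (intro dvd_sum, auto)
    moreover have "even (\<Sum>w\<in>?W. y w * (\<Sum>z\<in>V. of_bool (adj w z) * x z))"
      using x0(3) by (intro dvd_sum) (auto simp: xs)
    ultimately have "even (\<Sum>z\<in>V. of_bool (adj v z) * x z)"
      using v assms(1) by (auto simp: sum.remove[of V v "\<lambda>w. y w * _ w"])
    then have x: "\<forall>w\<in>V. even (\<Sum>z\<in>V. of_bool (adj w z) * x z)"
      using x0(3) xs by (metis Diff_iff singletonD)
    have xv': "v' \<in> V" "odd (x v')" "x v = 0" using x0 by (auto simp: x_def)
    show False
    proof (cases "even (\<Sum>z\<in>V. x z)")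
      case True
      then show ?thesis using ker[of x v'] x xv' by auto
    next
      case False
      \<comment> \<open>Two odd sums add to an even one, so \<open>x + y\<close> lies in the kernel
        of \<open>J - A\<close> modulo 2 although it is odd at \<open>v\<close>.\<close>
      then have "even (\<Sum>z\<in>V. x z + y z)" using oddsum by (simp add: sum.distrib)
      moreover have "even (\<Sum>z\<in>V. of_bool (adj w z) * (x z + y z))" if "w \<in> V" for w
        using x y that by (simp add: distrib_left sum.distrib)
      ultimately have "even (x v + y v)" using v(1) by (intro ker) auto
      then show False using xv' v by simp
    qed
  qed
qed

section \<open>Existence and deletion of leaves in sparse graphs nonsingular modulo 2\<close>

lemma nonsingular2_twin_free:
  assumes "nonsingular2 adj W" "finite W" "p \<in> W" "q \<in> W" "p \<noteq> q"
  shows "\<exists>w\<in>W. adj w p \<noteq> adj w q"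
proof (rule ccontr)
  assume twin: "\<not> ?thesis"
  \<comment> \<open>Equal columns \<open>p\<close> and \<open>q\<close> cancel modulo 2.\<close>
  let ?x = "\<lambda>z. of_bool (z = p) + of_bool (z = q) :: int"
  have "(\<Sum>z\<in>W. of_bool (adj w z) * ?x z) = of_bool (adj w p) + of_bool (adj w q)" for w
    using assms by (simp add: distrib_left sum.distrib if_distrib[of "(*) _"] of_bool_def cong: if_cong)
  then have "\<forall>w\<in>W. even (\<Sum>z\<in>W. of_bool (adj w z) * ?x z)" using twin by auto
  from nonsingular2D[OF assms(1) this assms(3)] have "even (?x p)" .
  then show False using assms(5) by simp
qed

text \<open>If all degrees were even, the all-ones vector would lie in the kernel.\<close>

lemma nonsingular2_not_eulerian:
  assumes "nonsingular2 adj W" "W \<noteq> {}"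
  shows "\<exists>w\<in>W. odd (\<Sum>z\<in>W. of_bool (adj w z) :: int)"
  using assms unfolding nonsingular2_def by (auto dest!: spec[of _ "\<lambda>_. 1"])

lemma degree_eq_card:
  "finite W \<Longrightarrow> (\<Sum>z\<in>W. of_bool (adj w z) :: int) = int (card {z\<in>W. adj w z})"
  by (simp add: sum_of_bool_eq Int_def)

lemma nonsingular2_no_isolated:
  assumes "nonsingular2 adj W" "symp adj" "finite W" "v \<in> W"
  shows "\<exists>w\<in>W. adj v w"
proof (rule ccontr)
  assume iso: "\<not> ?thesis"
  let ?x = "\<lambda>z. of_bool (z = v) :: int"
  have "\<forall>w\<in>W. even (\<Sum>z\<in>W. of_bool (adj w z) * ?x z)"
    using iso assms(2) by (auto intro!: dvd_sum dest: sympD)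
  from nonsingular2D[OF assms(1) this assms(4)] have "even (?x v)" .
  then show False by simp
qed

text \<open>Without leaves all degrees are at least 2, so the degree bound leaves at most 6
  vertices. Order 2 is too small for degree 2. On 4 vertices the degree sum is at most 10, so some
  two vertices are not adjacent; both are joined to the other two and are twins. On 6 vertices all
  degrees are exactly 2, hence even.\<close>

lemma nonsingular2_has_leaf:
  assumes ns: "nonsingular2 adj W" and "symp adj" "irreflp adj" "finite W" "W \<noteq> {}" "even (card W)"
    and few: "(\<Sum>w\<in>W. \<Sum>z\<in>W. of_bool (adj w z)) \<le> int (card W) + 6"
  shows "\<exists>v\<in>W. \<exists>u\<in>W. {z\<in>W. adj v z} = {u}"
proof (rule ccontr)
  assume no_leaf: "\<not> ?thesis"
  let ?N = "\<lambda>v. {z\<in>W. adj v z}"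
  have irr: "\<not> adj x x" for x using assms(3) by (auto dest: irreflpD)
  have deg2: "2 \<le> card (?N v)" if v: "v \<in> W" for v
  proof -
    have "?N v \<noteq> {}" using nonsingular2_no_isolated[OF ns assms(2,4) v] by auto
    then have "card (?N v) \<noteq> 0" using assms(4) by simp
    moreover have "card (?N v) \<noteq> 1" using no_leaf v by (force simp: card_1_singleton_iff)
    ultimately show ?thesis by simp
  qed
  have few': "(\<Sum>w\<in>W. card (?N w)) \<le> card W + 6"
    using few by (simp add: degree_eq_card assms(4) flip: of_nat_sum)
  have "2 * card W \<le> (\<Sum>w\<in>W. card (?N w))"
    using sum_mono[of W "\<lambda>_. 2" "\<lambda>w. card (?N w)"] deg2 by (simp add: mult.commute)
  then have c6: "card W \<le> 6" using few' by simp
  have "card W \<noteq> 0" using assms(4,5) by simp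
  have sub: "?N p \<subseteq> W - {p}" for p using irr by auto
  obtain p0 where p0: "p0 \<in> W" using assms(5) by auto
  have "card W \<noteq> 2"
    using card_mono[OF _ sub[of p0]] deg2[OF p0] p0 assms(4) by auto
  then consider "card W = 4" | "card W = 6"
    using c6 \<open>card W \<noteq> 0\<close> \<open>even (card W)\<close> by (auto elim!: evenE) linarith
  then show False
  proof cases
    case 1
    have "\<exists>p\<in>W. \<exists>q\<in>W. p \<noteq> q \<and> \<not> adj p q"
    proof (rule ccontr)
      assume complete: "\<not> ?thesis"
      have "?N p = W - {p}" if "p \<in> W" for p using complete that irr by auto
      then have "(\<Sum>w\<in>W. card (?N w)) = (\<Sum>w\<in>W. 3)" using 1 assms(4) by (intro sum.cong) auto
      then show False using few' 1 by simp
    qed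
    then obtain p q where pq: "p \<in> W" "q \<in> W" "p \<noteq> q" "\<not> adj p q" by auto
    then have "\<not> adj q p" using assms(2) by (auto dest: sympD)
    have card2: "card (W - {p, q}) = 2" using pq 1 assms(4) by (simp add: card_Diff_subset)
    have "?N p \<subseteq> W - {p, q}" "?N q \<subseteq> W - {p, q}" using pq(4) \<open>\<not> adj q p\<close> irr by auto
    then have "?N p = W - {p, q}" "?N q = W - {p, q}"
      using deg2[OF pq(1)] deg2[OF pq(2)] assms(4)
      by (intro card_seteq; simp add: card2 del: card_Diff_insert)+
    then have "adj p w = adj q w" if "w \<in> W" for w using that by blast
    then have "adj w p = adj w q" if "w \<in> W" for w
      using that assms(2) by (metis sympD)
    then show False using nonsingular2_twin_free[OF ns assms(4) pq(1-3)] by auto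
  next
    case 2
    have "card (?N v) = 2" if v: "v \<in> W" for v
    proof (rule ccontr)
      assume "card (?N v) \<noteq> 2"
      then have "(\<Sum>w\<in>W. 2) < (\<Sum>w\<in>W. card (?N w))"
        using deg2 v assms(4) by (intro sum_strict_mono_ex1) (auto intro!: bexI[of _ v] simp: le_neq_implies_less)
      then show False using few' 2 by simp
    qed
    then show False using nonsingular2_not_eulerian[OF ns assms(5)] assms(4) by (simp add: degree_eq_card)
  qed
qed

text \<open>A kernel vector of the smaller graph extends: 0 at \<open>u\<close> leaves the other
  rows alone, and the value at \<open>v\<close> repeats the rest of row \<open>u\<close>, which
  becomes even.\<close>

lemma nonsingular2_delete_leaf:
  assumes ns: "nonsingular2 adj (insert u (insert v W))" and "symp adj" "irreflp adj" "finite W"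
    and "u \<notin> W" "v \<notin> W" "u \<noteq> v" "adj v u" "\<forall>w\<in>W. \<not> adj v w"
  shows "nonsingular2 adj W"
  unfolding nonsingular2_def
proof (intro allI impI)
  fix x :: "'a \<Rightarrow> int"
  assume x: "\<forall>w\<in>W. even (\<Sum>z\<in>W. of_bool (adj w z) * x z)"
  define y where "y = (\<lambda>w. if w = u then 0 else if w = v then \<Sum>z\<in>W. of_bool (adj u z) * x z else x w)"
  have ysum: "(\<Sum>z\<in>W. of_bool (adj w z) * y z) = (\<Sum>z\<in>W. of_bool (adj w z) * x z)" for w
    by (rule sum.cong) (use assms in \<open>auto simp: y_def\<close>)
  have "(\<Sum>z\<in>W. of_bool (adj v z) * x z) = 0" by (rule sum.neutral) (use assms in auto)
  moreover have "adj u v" "\<And>w. w \<in> W \<Longrightarrow> \<not> adj w v" "\<not> adj v v"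
    using assms(2,3,8,9) by (auto dest: sympD irreflpD)
  ultimately have "\<forall>w\<in>insert u (insert v W). even (\<Sum>z\<in>insert u (insert v W). of_bool (adj w z) * y z)"
    using assms(4-8) x by (auto simp: ysum) (auto simp: y_def)
  then have "\<forall>w\<in>W. even (y w)" using ns unfolding nonsingular2_def by blast
  then show "\<forall>w\<in>W. even (x w)" using assms(5,6) by (auto simp: y_def split: if_splits)
qed

text \<open>The degree bound survives a deletion: the order drops by 2 and the degree sum by at
  least 2.\<close>

lemma nonsingular2_leaf_elim:
  assumes "nonsingular2 adj W" "symp adj" "irreflp adj" "finite W" "even (card W)"
    and "(\<Sum>w\<in>W. \<Sum>z\<in>W. of_bool (adj w z)) \<le> int (card W) + 6"
  shows "\<exists>ps. leaf_elim adj ps \<and> verts ps = W"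
  using assms
proof (induction "card W" arbitrary: W rule: less_induct)
  case less
  show ?case
  proof (cases "W = {}")
    case True
    then show ?thesis by (intro exI[of _ "[]"]) simp
  next
    case False
    then obtain u v where uv: "v \<in> W" "u \<in> W" "{z\<in>W. adj v z} = {u}"
      using nonsingular2_has_leaf[of adj W] less.prems by blast
    define W' where "W' = W - {u, v}"
    have adj: "adj v u" "adj u v" "\<not> adj v v" "\<not> adj u u"
      using uv less.prems(2,3) by (auto dest: sympD irreflpD)
    then have ne: "u \<noteq> v" by auto
    have W: "W = insert u (insert v W')" "u \<notin> W'" "v \<notin> W'" "finite W'"
      using uv less.prems(4) by (auto simp: W'_def)
    have leaf: "\<forall>w\<in>W'. \<not> adj v w" using uv(3) by (auto simp: W'_def)
    have out: "\<And>w. w \<in> W' \<Longrightarrow> \<not> adj w v" using leaf less.prems(2) by (auto dest: sympD)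
    have card: "card W = Suc (Suc (card W'))" using W ne by simp
    have "(\<Sum>z\<in>W'. of_bool (adj v z) :: int) = 0" by (rule sum.neutral) (use leaf in auto)
    then have "(\<Sum>w\<in>W. \<Sum>z\<in>W. of_bool (adj w z) :: int) =
        2 + (\<Sum>z\<in>W'. of_bool (adj u z)) + (\<Sum>z\<in>W'. of_bool (adj z u)) + (\<Sum>w\<in>W'. \<Sum>z\<in>W'. of_bool (adj w z))"
      using W ne adj out by (simp add: sum.distrib)
    moreover have "0 \<le> (\<Sum>z\<in>W'. of_bool (adj u z) :: int)" "0 \<le> (\<Sum>z\<in>W'. of_bool (adj z u) :: int)"
      by (simp_all add: sum_nonneg)
    ultimately have "(\<Sum>w\<in>W'. \<Sum>z\<in>W'. of_bool (adj w z)) \<le> int (card W') + 6"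
      using less.prems(6) card by simp
    moreover have "nonsingular2 adj W'"
      by (rule nonsingular2_delete_leaf[of adj u v]) (use W ne adj leaf less.prems in auto)
    ultimately obtain ps where "leaf_elim adj ps" "verts ps = W'"
      using less.hyps[of W'] card W less.prems by auto
    then show ?thesis using W ne adj leaf by (intro exI[of _ "(u, v) # ps"]) auto
  qed
qed

section \<open>Complements, pendant graphs and winnability\<close>

lemma sum_adj_eq_twice_card:
  assumes "graph V F"
  shows "(\<Sum>w\<in>V. \<Sum>z\<in>V. of_bool ({w, z} \<in> F)) = 2 * int (card F)"
proof -
  have fin: "finite V" and F: "\<And>e. e \<in> F \<Longrightarrow> e \<subseteq> V \<and> card e = 2"
    using assms by (auto simp: graph_def)
  have "F \<subseteq> Pow V" using F by auto
  then have finF: "finite F" using fin by (auto intro: finite_subset)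
  let ?D = "\<lambda>e. {(w, z). w \<noteq> z \<and> {w, z} = e}"
  have D: "finite (?D e) \<and> card (?D e) = 2" if e: "e \<in> F" for e
  proof -
    obtain x y where "e = {x, y}" "x \<noteq> y" using F[OF e] by (auto simp: card_2_iff)
    then have "?D e = {(x, y), (y, x)}" by (auto simp: doubleton_eq_iff)
    then show ?thesis using \<open>x \<noteq> y\<close> by simp
  qed
  have "(\<Sum>w\<in>V. \<Sum>z\<in>V. of_bool ({w, z} \<in> F)) = (\<Sum>p\<in>V \<times> V. of_bool ({fst p, snd p} \<in> F) :: int)"
    by (simp add: sum.cartesian_product case_prod_unfold)
  also have "\<dots> = int (card (V \<times> V \<inter> {p. {fst p, snd p} \<in> F}))"
    using fin by (simp add: sum_of_bool_eq)
  also have "V \<times> V \<inter> {p. {fst p, snd p} \<in> F} = (\<Union>e\<in>F. ?D e)"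
    using F by (fastforce simp: card_2_iff)
  also have "card \<dots> = (\<Sum>e\<in>F. card (?D e))"
    using finF D by (intro card_UN_disjoint) auto
  also have "\<dots> = 2 * card F" using D by simp
  finally show ?thesis by simp
qed

lemma all_edges_eq: "{{u, v} | u v. u \<in> V \<and> v \<in> V \<and> u \<noteq> v} = {e. e \<subseteq> V \<and> card e = 2}"
  by (auto simp: card_2_iff)

lemma graph_compl: "finite V \<Longrightarrow> graph V (compl_edges V E)"
  by (auto simp: graph_def compl_edges_def)

lemma mem_compl_edges:
  "v \<in> V \<Longrightarrow> w \<in> V \<Longrightarrow> {v, w} \<in> compl_edges V E \<longleftrightarrow> v \<noteq> w \<and> {v, w} \<notin> E"
  by (auto simp: compl_edges_def doubleton_eq_iff)

lemma compl_compl_edges: "graph V E \<Longrightarrow> compl_edges V (compl_edges V E) = E"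
  unfolding compl_edges_def all_edges_eq by (auto simp: graph_def)

lemma card_compl_edges:
  assumes "graph V E"
  shows "card E + card (compl_edges V E) = card V choose 2"
proof -
  have fin: "finite V" and sub: "E \<subseteq> {e. e \<subseteq> V \<and> card e = 2}" using assms by (auto simp: graph_def)
  then have "finite {e. e \<subseteq> V \<and> card e = 2}" by (auto intro: finite_subset[of _ "Pow V"])
  then show ?thesis
    unfolding compl_edges_def all_edges_eq using sub fin
    by (simp add: card_Diff_subset finite_subset card_mono flip: n_subsets)
qed

text \<open>Describes a corona inside \<open>V\<close> itself, without sum type or isomorphism:
  \<open>U\<close> carries the base graph and \<open>g u\<close> is the pendant vertex at
  \<open>u\<close>.\<close>

definition leaf_matching :: "'a set \<Rightarrow> 'a set set \<Rightarrow> 'a set \<Rightarrow> ('a \<Rightarrow> 'a) \<Rightarrow> bool" where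
  "leaf_matching V F U g \<longleftrightarrow> inj_on g U \<and> U \<inter> g ` U = {} \<and> V = U \<union> g ` U \<and>
     (\<forall>u\<in>U. \<forall>w\<in>V. {g u, w} \<in> F \<longleftrightarrow> w = u)"

lemma leaf_matching_imp_pendant:
  assumes "graph V F" "leaf_matching V F U g"
  shows "is_pendant V F"
proof -
  have g: "inj_on g U" "U \<inter> g ` U = {}" "V = U \<union> g ` U"
    "\<And>u w. u \<in> U \<Longrightarrow> w \<in> V \<Longrightarrow> {g u, w} \<in> F \<longleftrightarrow> w = u"
    using assms(2) by (auto simp: leaf_matching_def)
  \<comment> \<open>The base graph is the one induced on \<open>U\<close>.\<close>
  define EH where "EH = {e\<in>F. e \<subseteq> U}"
  define f where "f = case_sum id g"
  have f [simp]: "f (Inl u) = u" "f (Inr u) = g u" for u by (simp_all add: f_def)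
  have "graph U EH" using assms(1) g(3) by (auto simp: graph_def EH_def)
  moreover have "bij_betw f (corona_V U) V"
  proof -
    have "f ` corona_V U = V" unfolding corona_V_def image_Un image_image f g(3) by simp
    moreover have "inj_on f (corona_V U)"
      using g(1,2) unfolding corona_V_def by (intro inj_on_Un[THEN iffD2]) (auto simp: inj_on_def)
    ultimately show ?thesis by (simp add: bij_betw_def)
  qed
  moreover have "{p, q} \<in> corona_E U EH \<longleftrightarrow> {f p, f q} \<in> F"
    if p: "p \<in> corona_V U" and q: "q \<in> corona_V U" for p q
  proof -
    have LL: "{Inl u, Inl w} \<in> corona_E U EH \<longleftrightarrow> {u, w} \<in> F" if "u \<in> U" "w \<in> U" for u w
    proof -
      have "(Inl ` {u, w} :: ('a + 'a) set) \<in> (\<lambda>e. Inl ` e) ` EH \<longleftrightarrow> {u, w} \<in> EH"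
        by (rule inj_image_mem_iff) (simp add: inj_def inj_image_eq_iff)
      then show ?thesis using that by (auto simp: corona_E_def EH_def doubleton_eq_iff)
    qed
    have LR: "{Inl u, Inr w} \<in> corona_E U EH \<longleftrightarrow> u = w" if "u \<in> U" "w \<in> U" for u w
      using that by (auto simp: corona_E_def doubleton_eq_iff)
    have RR: "{Inr u, Inr w} \<notin> corona_E U EH" for u w
      by (auto simp: corona_E_def doubleton_eq_iff)
    from p q consider u w where "p = Inl u" "q = Inl w" "u \<in> U" "w \<in> U"
      | u w where "p = Inl u" "q = Inr w" "u \<in> U" "w \<in> U"
      | u w where "p = Inr u" "q = Inl w" "u \<in> U" "w \<in> U"
      | u w where "p = Inr u" "q = Inr w" "u \<in> U" "w \<in> U"
      unfolding corona_V_def by blast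
    then show ?thesis
    proof cases
      case 1 then show ?thesis using LL by simp
    next
      case 2 then show ?thesis using LR g(4)[of w u] g(3) by (auto simp: insert_commute)
    next
      case 3 then show ?thesis using LR[of w u] g(4)[of u w] g(3) by (auto simp: insert_commute)
    next
      case 4 then show ?thesis using RR g(4)[of u "g w"] g(2,3) by auto
    qed
  qed
  ultimately show ?thesis using assms(1) unfolding is_pendant_def graph_iso_def by blast
qed

lemma pendant_imp_leaf_matching:
  assumes "is_pendant V F"
  shows "\<exists>U g. leaf_matching V F U g"
proof -
  obtain VH :: "'a set" and EH f where bij: "bij_betw f (corona_V VH) V"
    and adj: "\<And>p q. p \<in> corona_V VH \<Longrightarrow> q \<in> corona_V VH \<Longrightarrow> {p, q} \<in> corona_E VH EH \<longleftrightarrow> {f p, f q} \<in> F"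
    using assms unfolding is_pendant_def graph_iso_def by blast
  have inj: "f p = f q \<longleftrightarrow> p = q" if "p \<in> corona_V VH" "q \<in> corona_V VH" for p q
    using bij that by (auto simp: bij_betw_def inj_on_def)
  have mem: "Inl u \<in> corona_V VH" "Inr u \<in> corona_V VH" if "u \<in> VH" for u
    using that by (auto simp: corona_V_def)
  have V: "V = (\<lambda>u. f (Inl u)) ` VH \<union> (\<lambda>u. f (Inr u)) ` VH"
    using bij by (auto simp: bij_betw_def corona_V_def image_Un image_image)
  define h where "h = inv_into VH (\<lambda>u. f (Inl u))"
  have injL: "inj_on (\<lambda>u. f (Inl u)) VH" using inj mem by (auto simp: inj_on_def)
  have h: "h (f (Inl u)) = u" if "u \<in> VH" for u
    unfolding h_def using inv_into_f_f[OF injL that] by simp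
  define U where "U = (\<lambda>u. f (Inl u)) ` VH"
  define g where "g w = f (Inr (h w))" for w
  have gU: "g ` U = (\<lambda>u. f (Inr u)) ` VH" unfolding U_def image_image g_def by (rule image_cong) (auto simp: h)
  have "inj_on g U" by (auto simp: inj_on_def U_def g_def h inj mem)
  moreover have "U \<inter> g ` U = {}" unfolding gU by (auto simp: U_def inj mem)
  moreover have "V = U \<union> g ` U" using V gU U_def by simp
  moreover have "{g u, w} \<in> F \<longleftrightarrow> w = u" if u: "u \<in> U" and w: "w \<in> V" for u w
  proof -
    obtain u' where u': "u' \<in> VH" "u = f (Inl u')" using u by (auto simp: U_def)
    obtain q where q: "q \<in> corona_V VH" "w = f q" using w bij by (auto simp: bij_betw_def)
    have "{g u, w} \<in> F \<longleftrightarrow> {Inr u', q} \<in> corona_E VH EH"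
      using adj[of "Inr u'" q] u' q mem by (simp add: g_def h)
    also have "\<dots> \<longleftrightarrow> q = Inl u'"
      using u' q by (auto simp: corona_E_def corona_V_def doubleton_eq_iff)
    also have "\<dots> \<longleftrightarrow> w = u" using inj[of q "Inl u'"] u' q mem by simp
    finally show ?thesis .
  qed
  ultimately show ?thesis unfolding leaf_matching_def by blast
qed

section \<open>The game matrix in terms of the complement\<close>

abbreviation nonadj :: "'a set \<Rightarrow> 'a set set \<Rightarrow> 'a \<Rightarrow> 'a \<Rightarrow> bool" where
  "nonadj V E u v \<equiv> {u, v} \<in> compl_edges V E"

lemma symp_nonadj: "symp (nonadj V E)"
  by (auto intro!: sympI simp: insert_commute)

lemma irreflp_nonadj: "irreflp (nonadj V E)"
  by (auto intro!: irreflpI simp: compl_edges_def doubleton_eq_iff)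

text \<open>This is row \<open>w\<close> of \<open>J - A\<close>: a closed neighbourhood omits
  exactly the neighbours in the complement.\<close>

lemma toggle_sum:
  assumes "finite V" "w \<in> V"
  shows "(\<Sum>v\<in>V. if v = w \<or> {v, w} \<in> E then x v else 0) =
    (\<Sum>v\<in>V. x v) - (\<Sum>v\<in>V. of_bool (nonadj V E w v) * (x v :: int))"
proof -
  have "(\<Sum>v\<in>V. if v = w \<or> {v, w} \<in> E then x v else 0) = (\<Sum>v\<in>V. x v - of_bool (nonadj V E w v) * x v)"
    using assms(2) by (intro sum.cong refl) (auto simp: mem_compl_edges insert_commute)
  then show ?thesis by (simp add: sum_subtractf)
qed

text \<open>Integer toggle counts may replace natural ones by reduction modulo \<open>l\<close>,
  which allows subtraction of solutions.\<close>

lemma N_AW_iff: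
  assumes "finite V" "l > 0"
  shows "N_AW l V E \<longleftrightarrow> (\<forall>c :: 'a \<Rightarrow> int. \<exists>x :: 'a \<Rightarrow> int. \<forall>w\<in>V.
    int l dvd c w + ((\<Sum>v\<in>V. x v) - (\<Sum>v\<in>V. of_bool (nonadj V E w v) * x v)))"
proof -
  let ?T = "\<lambda>w x. \<Sum>v\<in>V. if v = w \<or> {v, w} \<in> E then x v else (0::int)"
  have "(\<exists>x :: 'a \<Rightarrow> nat. \<forall>w\<in>V. (c w + ?T w (\<lambda>v. int (x v))) mod int l = 0) \<longleftrightarrow>
        (\<exists>x. \<forall>w\<in>V. int l dvd c w + ?T w x)" for c
  proof
    assume "\<exists>x. \<forall>w\<in>V. int l dvd c w + ?T w x"
    then obtain x where x: "\<forall>w\<in>V. int l dvd c w + ?T w x" by blast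
    define y where "y v = nat (x v mod int l)" for v
    have y: "int (y v) = x v mod int l" for v using assms(2) by (simp add: y_def)
    have "int l dvd ?T w (\<lambda>v. int (y v)) - ?T w x" for w
      unfolding sum_subtractf[symmetric]
      by (rule dvd_sum) (auto simp: y mod_eq_dvd_iff[symmetric])
    then have "int l dvd c w + ?T w (\<lambda>v. int (y v))" if "w \<in> V" for w
      using dvd_add[of "int l" "c w + ?T w x" "?T w (\<lambda>v. int (y v)) - ?T w x"] x that by (simp add: algebra_simps)
    then show "\<exists>x :: 'a \<Rightarrow> nat. \<forall>w\<in>V. (c w + ?T w (\<lambda>v. int (x v))) mod int l = 0"
      by (intro exI[of _ y]) (auto simp: mod_eq_0_iff_dvd)
  qed (auto simp: mod_eq_0_iff_dvd)
  then show ?thesis unfolding N_AW_def by (simp add: toggle_sum[OF assms(1)])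
qed

text \<open>Surjectivity modulo \<open>l\<close> of the symmetric matrix \<open>J - A\<close> yields injectivity modulo every
  divisor \<open>d\<close>: pair a kernel vector with a preimage of each unit vector.\<close>
lemma N_AW_kernel:
  assumes "finite V" "l > 0" "N_AW l V E" "d dvd int l"
    and y: "\<forall>w\<in>V. d dvd (\<Sum>z\<in>V. y z) - (\<Sum>z\<in>V. of_bool (nonadj V E w z) * y z)" and "w \<in> V"
  shows "d dvd y w"
proof -
  let ?B = "\<lambda>x w. (\<Sum>z\<in>V. x z) - (\<Sum>z\<in>V. of_bool (nonadj V E w z) * (x z :: int))"
  obtain x where x: "\<forall>v\<in>V. int l dvd - of_bool (v = w) + ?B x v"
    using assms(3) unfolding N_AW_iff[OF assms(1,2)] by (meson spec[of _ "\<lambda>v. - of_bool (v = w)"])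
  have "(\<Sum>v\<in>V. y v * ?B x v) = (\<Sum>v\<in>V. x v * ?B y v)"
    using adj_form_swap[OF symp_nonadj[of V E], of y x V]
    by (simp add: right_diff_distrib sum_subtractf flip: sum_distrib_right)
  moreover have "d dvd (\<Sum>v\<in>V. x v * ?B y v)" using y by (intro dvd_sum) auto
  moreover have "d dvd (\<Sum>v\<in>V. y v * (- of_bool (v = w) + ?B x v))"
    using x by (intro dvd_sum dvd_mult dvd_trans[OF assms(4)]) blast
  moreover have "(\<Sum>v\<in>V. y v * (- of_bool (v = w) + ?B x v)) = (\<Sum>v\<in>V. y v * ?B x v) - y w"
  proof -
    have "(\<Sum>v\<in>V. y v * of_bool (v = w)) = y w"
      using assms(1,6) by (simp add: of_bool_def if_distrib[of "(*) _"] cong: if_cong)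
    then show ?thesis by (simp add: right_diff_distrib sum_subtractf)
  qed
  ultimately show ?thesis by (simp add: dvd_diff_right_iff)
qed

text \<open>With \<open>B\<close> the adjacency matrix on \<open>U\<close>, \<open>A\<close> has
  blocks \<open>B, I; I, 0\<close> and the integral inverse \<open>0, I; I, -B\<close>. Since the
  entries of \<open>B\<close> sum to \<open>2 * k\<close>, the solution for the all-ones vector has
  entry sum \<open>2 * m - 2 * k\<close>.\<close>

lemma leaf_matching_N_AW:
  assumes "graph V E" "l > 0" and lm: "leaf_matching V (compl_edges V E) U g"
    and card: "card V = 2 * m" "card (compl_edges V E) = m + k"
    and cop: "coprime (2 * int m - 2 * int k - 1) (int l)"
  shows "N_AW l V E"
proof -
  let ?A = "\<lambda>w z. of_bool (nonadj V E w z) :: int"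
  have fin: "finite V" using assms(1) by (auto simp: graph_def)
  have g: "inj_on g U" "U \<inter> g ` U = {}" "V = U \<union> g ` U"
    "\<And>u w. u \<in> U \<Longrightarrow> w \<in> V \<Longrightarrow> nonadj V E (g u) w \<longleftrightarrow> w = u"
    using lm by (auto simp: leaf_matching_def)
  have finU: "finite U" using fin g(3) by auto
  have split: "(\<Sum>z\<in>V. f z) = (\<Sum>u\<in>U. f u) + (\<Sum>u\<in>U. f (g u))" for f :: "'a \<Rightarrow> int"
    using g(1-3) finU by (simp add: sum.union_disjoint sum.reindex)
  have g': "nonadj V E u (g u') \<longleftrightarrow> u = u'" if "u \<in> U" "u' \<in> U" for u u'
    using g(4)[of u' u] g(3) that by (auto simp: insert_commute)
  have g'': "\<not> nonadj V E (g u) (g u')" if "u \<in> U" "u' \<in> U" for u u'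
    using g(4)[of u "g u'"] g(2,3) that by auto
  have cU: "card U = m" using card(1) g(1-3) finU by (simp add: card_Un_disjoint card_image)
  define sol where "sol c w = (if w \<in> U then c (g w) else
      c (inv_into U g w) - (\<Sum>u\<in>U. ?A (inv_into U g w) u * c (g u)))" for c w
  have solU: "sol c u = c (g u)" "sol c (g u) = c u - (\<Sum>u'\<in>U. ?A u u' * c (g u'))" if "u \<in> U" for c u
    using that g(1,2) by (auto simp: sol_def inv_into_f_f)
  have delta: "(\<Sum>u'\<in>U. of_bool (u = u') * f u') = f u" if "u \<in> U" for u and f :: "'a \<Rightarrow> int"
    using that finU by (simp add: of_bool_def if_distrib[of "\<lambda>x. x * _"] cong: if_cong)
  have solve: "(\<Sum>z\<in>V. ?A w z * sol c z) = c w" if w: "w \<in> V" for c w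
  proof -
    consider u where "u \<in> U" "w = u" | u where "u \<in> U" "w = g u" using w g(3) by auto
    then show ?thesis
    proof cases
      case 1
      have "(\<Sum>u'\<in>U. ?A u (g u') * sol c (g u')) = (\<Sum>u'\<in>U. of_bool (u = u') * sol c (g u'))"
        using 1 g' by (intro sum.cong) auto
      then show ?thesis unfolding split using 1 delta[of u] by (simp add: solU)
    next
      case 2
      have "(\<Sum>u'\<in>U. ?A (g u) u' * sol c u') = (\<Sum>u'\<in>U. of_bool (u = u') * sol c u')"
        using 2 g(4) g(3) by (intro sum.cong) auto
      moreover have "(\<Sum>u'\<in>U. ?A (g u) (g u') * sol c (g u')) = 0"
        using 2 g'' by (intro sum.neutral) auto
      ultimately show ?thesis unfolding split using 2 delta[of u] by (simp add: solU)
    qed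
  qed
  have "(\<Sum>w\<in>V. \<Sum>z\<in>V. ?A w z) = (\<Sum>u\<in>U. \<Sum>u'\<in>U. ?A u u') + 2 * int m"
  proof -
    have "(\<Sum>u'\<in>U. ?A u (g u')) = 1" "(\<Sum>u'\<in>U. ?A (g u) u') = 1" "(\<Sum>u'\<in>U. ?A (g u) (g u')) = 0"
      if u: "u \<in> U" for u
    proof -
      have "(\<Sum>u'\<in>U. ?A u (g u')) = (\<Sum>u'\<in>U. of_bool (u = u') * 1)"
        using u g' by (intro sum.cong) auto
      then show "(\<Sum>u'\<in>U. ?A u (g u')) = 1" using delta[OF u, of "\<lambda>_. 1"] by simp
      have "(\<Sum>u'\<in>U. ?A (g u) u') = (\<Sum>u'\<in>U. of_bool (u = u') * 1)"
        using u g(3,4) by (intro sum.cong) auto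
      then show "(\<Sum>u'\<in>U. ?A (g u) u') = 1" using delta[OF u, of "\<lambda>_. 1"] by simp
      show "(\<Sum>u'\<in>U. ?A (g u) (g u')) = 0" using u g'' by (intro sum.neutral) auto
    qed
    then show ?thesis by (simp add: split sum.distrib cU)
  qed
  then have "(\<Sum>u\<in>U. \<Sum>u'\<in>U. ?A u u') = 2 * int k"
    using sum_adj_eq_twice_card[OF graph_compl[OF fin, of E]] card(2) by simp
  then have total: "(\<Sum>z\<in>V. sol (\<lambda>_. 1) z) = 2 * int m - 2 * int k"
    unfolding split by (simp add: solU sum_subtractf cU)
  obtain a b where ab: "a * (2 * int m - 2 * int k - 1) + b * int l = 1"
    using bezout_int[of "2 * int m - 2 * int k - 1" "int l"] cop by auto
  show ?thesis unfolding N_AW_iff[OF fin \<open>l > 0\<close>]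
  proof
    fix c :: "'a \<Rightarrow> int"
    define S where "S = (\<Sum>z\<in>V. sol c z)"
    \<comment> \<open>\<open>J - A\<close> maps \<open>sol c\<close> to \<open>S\<close> times the
      all-ones vector minus \<open>c\<close>. The multiple of \<open>sol\<close> at the all-ones
      vector cancels that constant modulo \<open>l\<close>, because \<open>a\<close> inverts
      \<open>2 * m - 2 * k - 1\<close> there.\<close>
    define x where "x z = sol c z - a * S * sol (\<lambda>_. 1) z" for z
    have "(\<Sum>z\<in>V. x z) = S - a * S * (2 * int m - 2 * int k)"
      by (simp add: x_def sum_subtractf S_def total flip: sum_distrib_left)
    moreover have "(\<Sum>z\<in>V. ?A w z * x z) = c w - a * S" if "w \<in> V" for w
    proof -
      have "(\<Sum>z\<in>V. ?A w z * x z) = (\<Sum>z\<in>V. ?A w z * sol c z) - a * S * (\<Sum>z\<in>V. ?A w z * sol (\<lambda>_. 1) z)"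
        by (simp add: x_def sum_distrib_left algebra_simps flip: sum_subtractf)
      then show ?thesis using solve[OF that] by simp
    qed
    ultimately have "c w + ((\<Sum>z\<in>V. x z) - (\<Sum>z\<in>V. ?A w z * x z)) = S * (1 - a * (2 * int m - 2 * int k - 1))"
      if "w \<in> V" for w using that by (simp add: algebra_simps)
    also have "\<dots> = int l * (S * b)"
    proof -
      have "1 - a * (2 * int m - 2 * int k - 1) = b * int l" using ab by linarith
      then show ?thesis by simp
    qed
    finally show "\<exists>x. \<forall>w\<in>V. int l dvd c w + ((\<Sum>z\<in>V. x z) - (\<Sum>z\<in>V. ?A w z * x z))"
      by (intro exI[of _ x]) simp
  qed
qed

section \<open>Graphs with few non-edges\<close>

lemma leaf_elim_adj: "leaf_elim adj ps \<Longrightarrow> (u, v) \<in> set ps \<Longrightarrow> adj u v"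
  by (induction ps rule: verts.induct) auto

text \<open>Here \<open>P y x\<close> reads as \<open>y\<close> being pendant at \<open>x\<close>.
  The leaf of a pair at deletion time need not be pendant in the whole graph, so each pair is
  oriented anew.\<close>

lemma leaf_elim_orient:
  assumes "leaf_elim adj ps" "\<forall>(u, v)\<in>set ps. P v u \<or> P u v"
  shows "\<exists>U g. inj_on g U \<and> U \<inter> g ` U = {} \<and> verts ps = U \<union> g ` U \<and> (\<forall>u\<in>U. P (g u) u)"
  using assms
proof (induction ps rule: verts.induct)
  case (2 u v ps)
  then obtain U g where g: "inj_on g U" "U \<inter> g ` U = {}" "verts ps = U \<union> g ` U" "\<forall>u\<in>U. P (g u) u"
    by auto
  have extend: "\<exists>U g. inj_on g U \<and> U \<inter> g ` U = {} \<and> insert x (insert y (verts ps)) = U \<union> g ` U \<and> (\<forall>u\<in>U. P (g u) u)"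
    if "x \<noteq> y" "x \<notin> verts ps" "y \<notin> verts ps" "P y x" for x y
  proof -
    have xU: "x \<notin> U" using that(2) g(3) by auto
    then have im: "g(x := y) ` insert x U = insert y (g ` U)" by auto
    have inj: "inj_on (g(x := y)) (insert x U)" using g(1,3) that(3) xU by (auto simp: inj_on_def)
    show ?thesis
      by (rule exI[of _ "insert x U"], rule exI[of _ "g(x := y)"])
        (use inj im g(2-4) that xU in auto)
  qed
  have "u \<noteq> v" "u \<notin> verts ps" "v \<notin> verts ps" using "2.prems"(1) by auto
  moreover have "P v u \<or> P u v" using "2.prems"(2) by simp
  ultimately show ?case using extend[of u v] extend[of v u] by (auto simp: insert_commute)
qed simp

lemma N_AW_few_nonedges:
  assumes "graph V E" "card V = 2 * m" "m > 0" "even l" "l > 0" "N_AW l V E"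
    and few: "card (compl_edges V E) \<le> m + 3"
  shows "\<exists>i. coprime (2 * int m - 2 * int i - 1) (int l) \<and> m + i \<le> card (compl_edges V E) \<and>
    (card (compl_edges V E) = m + i \<longrightarrow> is_pendant V (compl_edges V E))"
proof -
  let ?F = "compl_edges V E"
  let ?adj = "nonadj V E"
  have fin: "finite V" using assms(1) by (auto simp: graph_def)
  note sym = symp_nonadj[of V E] and irr = irreflp_nonadj[of V E]
  note kernel = N_AW_kernel[OF fin \<open>l > 0\<close> \<open>N_AW l V E\<close>]
  have "nonsingular2 ?adj V"
    by (rule nonsingular2_of_compl) (use fin sym irr assms(2) kernel[of 2] \<open>even l\<close> in auto)
  moreover have deg: "(\<Sum>w\<in>V. \<Sum>z\<in>V. of_bool (?adj w z)) = 2 * int (card ?F)"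
    by (rule sum_adj_eq_twice_card[OF graph_compl[OF fin]])
  ultimately obtain ps where ps: "leaf_elim ?adj ps" "verts ps = V"
    using nonsingular2_leaf_elim[of ?adj V] fin sym irr assms(2) few by auto
  have len: "length ps = m" using card_verts[OF ps(1)] ps(2) assms(2) by simp
  have ex: "extra ?adj ps = int (card ?F) - int m"
    using leaf_elim_degree_sum[OF sym irr ps(1)] ps(2) deg len by simp
  \<comment> \<open>The zero vector \<open>a\<close> corresponds to the all-ones right-hand
    side.\<close>
  define d where "d = deficit ?adj ps (\<lambda>_. 0)"
  have bounds: "0 \<le> d" "d \<le> extra ?adj ps"
    and pend: "d = extra ?adj ps \<Longrightarrow> \<forall>(u, v)\<in>set ps. (\<forall>w\<in>V. ?adj v w \<longrightarrow> w = u) \<or> (\<forall>w\<in>V. ?adj u w \<longrightarrow> w = v)"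
    using deficit_bounds[OF sym irr ps(1), of "\<lambda>_. 0"] ps(2) ex few by (auto simp: d_def)
  obtain x where x: "\<And>w. w \<in> V \<Longrightarrow> (\<Sum>z\<in>V. of_bool (?adj w z) * x z) = 1"
    and sx: "(\<Sum>z\<in>V. x z) = 2 * elim_form ?adj ps (\<lambda>_. 1)"
    using leaf_elim_solve[OF sym irr ps(1), of "\<lambda>_. 1"] ps(2) by auto
  have sum: "(\<Sum>z\<in>V. x z) = 2 * int m - 2 * d"
    using sx elim_form_deficit[of ?adj ps "\<lambda>_. 0"] len by (simp add: d_def)
  define i where "i = nat d"
  have i: "int i = d" using bounds by (simp add: i_def)
  \<comment> \<open>A common divisor \<open>c\<close> makes \<open>x\<close> a kernel vector of
    \<open>J - A\<close> modulo \<open>c\<close>, so it divides all entries of \<open>x\<close> and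
    hence the entry 1 of \<open>A x\<close>.\<close>
  have "coprime (2 * int m - 2 * d - 1) (int l)"
  proof (rule coprimeI)
    fix c assume c: "c dvd 2 * int m - 2 * d - 1" "c dvd int l"
    have V0: "V \<noteq> {}" using assms(2,3) by auto
    then obtain w where w: "w \<in> V" by auto
    have "\<forall>w\<in>V. c dvd x w" using kernel[OF c(2), of x] c(1) x sum by auto
    then have "c dvd (\<Sum>z\<in>V. of_bool (?adj w z) * x z)" by (intro dvd_sum) auto
    then show "is_unit c" using x[OF w] by simp
  qed
  moreover have "is_pendant V ?F" if "card ?F = m + i"
  proof -
    have "d = extra ?adj ps" using that ex i by simp
    then have or: "\<forall>(u, v)\<in>set ps. (\<forall>w\<in>V. ?adj v w \<longleftrightarrow> w = u) \<or> (\<forall>w\<in>V. ?adj u w \<longleftrightarrow> w = v)"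
      using pend leaf_elim_adj[OF ps(1)] sympD[OF sym] by fast
    obtain U g where "leaf_matching V ?F U g"
      using leaf_elim_orient[OF ps(1), of "\<lambda>v u. \<forall>w\<in>V. ?adj v w \<longleftrightarrow> w = u", OF or] ps(2)
      unfolding leaf_matching_def by blast
    then show ?thesis using leaf_matching_imp_pendant graph_compl[OF fin] by blast
  qed
  ultimately show ?thesis using bounds ex i by (intro exI[of _ i]) auto
qed

text \<open>The base graph is a star with centre 0 and \<open>k\<close> edges plus isolated
  vertices; \<open>k < m\<close> makes it fit.\<close>

lemma star_corona:
  assumes "k < m"
  shows "\<exists>F. graph {0..<2 * m} F \<and> card F = m + k \<and> leaf_matching {0..<2 * m} F {0..<m} (\<lambda>i. i + m)"
proof -
  define M where "M = (\<lambda>i. {i, i + m}) ` {0..<m}"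
  define S where "S = (\<lambda>i. {0, i}) ` {1..k}"
  have "card M = m" unfolding M_def
    by (subst card_image) (auto simp: inj_on_def doubleton_eq_iff)
  moreover have "card S = k" unfolding S_def
    by (subst card_image) (auto simp: inj_on_def doubleton_eq_iff)
  moreover have "M \<inter> S = {}" using assms by (auto simp: M_def S_def doubleton_eq_iff)
  ultimately have "card (M \<union> S) = m + k" by (subst card_Un_disjoint) (auto simp: M_def S_def)
  moreover have "graph {0..<2 * m} (M \<union> S)"
    using assms by (auto simp: graph_def M_def S_def card_insert_if)
  moreover have "leaf_matching {0..<2 * m} (M \<union> S) {0..<m} (\<lambda>i. i + m)"
  proof -
    have "{0..<2 * m} = {0..<m} \<union> (\<lambda>i. i + m) ` {0..<m}"
      by (simp add: image_add_atLeastLessThan' mult_2 ivl_disj_un)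
    moreover have "{u + m, w} \<in> M \<union> S \<longleftrightarrow> w = u" if "u < m" for u w
      using that assms by (auto simp: M_def S_def doubleton_eq_iff)
    ultimately show ?thesis by (auto simp: leaf_matching_def)
  qed
  ultimately show ?thesis by blast
qed

theorem theorem4p10:
  fixes n l k :: nat
  assumes "even n" "n > 0" "even l" "l > 0"
    and "coprime (int n - 2 * int k - 1) (int l)"
    and "\<forall>j<k. \<not> coprime (int n - 2 * int j - 1) (int l)"
    and "k \<le> 3"
  shows "max_edges n l = (n choose 2) - (n div 2 + k) \<and>
    (\<forall>(V :: 'a set) E. graph V E \<and> card V = n \<longrightarrow>
       (extremal n l V E \<longleftrightarrow>
          is_pendant V (compl_edges V E) \<and> card (compl_edges V E) = n div 2 + k
          \<and> card E = (n choose 2) - (n div 2 + k)))"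
proof -
  obtain m where n: "n = 2 * m" using assms(1) by (auto elim: evenE)
  have m: "m > 0" "n div 2 = m" using n assms(2) by auto
  \<comment> \<open>The index \<open>m - 1\<close> always qualifies, as it gives the value
    1.\<close>
  have km: "k < m"
  proof (rule ccontr)
    assume "\<not> k < m"
    then have "m - 1 < k" using m by simp
    then have "\<not> coprime (int n - 2 * int (m - 1) - 1) (int l)" using assms(6) by blast
    then show False using m n by (simp add: of_nat_diff)
  qed
  \<comment> \<open>The fresh type variable permits use both on \<open>{0..<n}\<close> for the
    maximum and on the given vertex type. Beyond \<open>m + 3\<close> non-edges the bound is strict
    because \<open>k\<close> is at most 3.\<close>
  have lower: "m + k \<le> card (compl_edges V E) \<and>
      (card (compl_edges V E) = m + k \<longrightarrow> is_pendant V (compl_edges V E))"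
    if g: "graph V E" "card V = n" "N_AW l V E" for V :: "'b set" and E
  proof (cases "card (compl_edges V E) \<le> m + 3")
    case True
    then obtain i where i: "coprime (int n - 2 * int i - 1) (int l)" "m + i \<le> card (compl_edges V E)"
      "card (compl_edges V E) = m + i \<longrightarrow> is_pendant V (compl_edges V E)"
      using N_AW_few_nonedges[of V E m l] g n m assms(3,4) by auto
    then have "k \<le> i" using assms(6) by (meson not_le)
    then show ?thesis using i(2,3) by auto
  qed (use assms(7) in auto)
  have winnable: "N_AW l V E"
    if "graph V E" "card V = n" "leaf_matching V (compl_edges V E) U g" "card (compl_edges V E) = m + k"
    for V :: "'b set" and E U g
    using leaf_matching_N_AW[OF that(1) assms(4) that(3) _ that(4)] that(2) n assms(5) by simp
  have max: "max_edges n l = (n choose 2) - (m + k)"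
    unfolding max_edges_def
  proof (rule Max_eqI)
    have "{card E | E. graph {0..<n} E \<and> N_AW l {0..<n} E} \<subseteq> card ` Pow (Pow {0..<n})"
      by (auto simp: graph_def)
    then show "finite {card E | E. graph {0..<n} E \<and> N_AW l {0..<n} E}"
      by (rule finite_subset) simp
    show "c \<le> (n choose 2) - (m + k)" if c: "c \<in> {card E | E. graph {0..<n} E \<and> N_AW l {0..<n} E}" for c
    proof -
      obtain E where E: "c = card E" "graph {0..<n} E" "N_AW l {0..<n} E" using c by blast
      then show ?thesis using lower[of "{0..<n}" E] card_compl_edges[of "{0..<n}" E] by auto
    qed
    obtain F where F: "graph {0..<n} F" "card F = m + k" "leaf_matching {0..<n} F {0..<m} (\<lambda>i. i + m)"
      using star_corona[OF km] n by auto
    define E where "E = compl_edges {0..<n} F"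
    have FE: "compl_edges {0..<n} E = F" using compl_compl_edges[OF F(1)] by (simp add: E_def)
    have gE: "graph {0..<n} E" by (simp add: E_def graph_compl)
    have "N_AW l {0..<n} E" using winnable[OF gE] F FE by simp
    moreover have "card E = (n choose 2) - (m + k)"
      using card_compl_edges[OF F(1)] F(2) by (simp add: E_def)
    ultimately show "(n choose 2) - (m + k) \<in> {card E | E. graph {0..<n} E \<and> N_AW l {0..<n} E}"
      using gE by force
  qed
  \<comment> \<open>The natural subtraction must not truncate, so that the edge count determines the
    number of non-edges.\<close>
  have "m + k \<le> 2 * m - 1" using km by simp
  also have "\<dots> \<le> m * (2 * m - 1)" using m by simp
  also have "\<dots> = n choose 2" by (simp add: choose_two n)
  finally have room: "m + k \<le> n choose 2" .
  show ?thesis unfolding m(2)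
  proof (intro conjI allI impI iffI max; (elim conjE)?)
    fix V :: "'a set" and E
    assume g: "graph V E" "card V = n" and ex: "extremal n l V E"
    have N: "N_AW l V E" and cE: "card E = (n choose 2) - (m + k)" using ex max by (auto simp: extremal_def)
    have "card (compl_edges V E) = m + k" using card_compl_edges[OF g(1)] g(2) cE room by simp
    with lower[OF g N] cE show "is_pendant V (compl_edges V E)" "card (compl_edges V E) = m + k"
      "card E = (n choose 2) - (m + k)" by auto
  next
    fix V :: "'a set" and E
    assume g: "graph V E" "card V = n" and p: "is_pendant V (compl_edges V E)"
      "card (compl_edges V E) = m + k" "card E = (n choose 2) - (m + k)"
    obtain U h where "leaf_matching V (compl_edges V E) U h" using pendant_imp_leaf_matching[OF p(1)] by blast
    then have "N_AW l V E" using winnable[OF g _ p(2)] by blast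
    then show "extremal n l V E" using g p(3) max by (simp add: extremal_def)
  qed
qed

end
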